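(* Let $A:=\mathbb{Z}\{X,Y\}$ and let $p$ be any prime number. Then there is no continuous surjective group homomorphism $\Psi: W(A)\to HH_0(E(A))$ which is compatible with $V$ and $\langle\ \rangle$, i.e. with $\Psi\circ V=V\circ\Psi$ and $\Psi(\langle a\rangle)=\langle a\rangle$ for all $a\in A$.
   Context: $\mathbb{N}_0=\{0,1,2,\dots\}$. $\mathbb{Z}\{X,Y\}$ is the free unital associative (non-commutative) polynomial ring over $\mathbb{Z}$ on two generators. For a ring $B$, $[B,B]$ denotes the additive subgroup generated by all $xy-yx$ with $x,y\in B$. Hesselholt's group $W(A)$. For $n\ge 1$ let $\omega: A^{n}\to (A/[A,A])^{n}$ be the map of sets with components, for $0\le i\le n-1$, the classes of $\omega_i(a_0,\dots,a_i)=a_0^{p^i}+pa_1^{p^{i-1}}+\cdots+p^ia_i$; define $\omega:A^{\mathbb{N}_0}\to(A/[A,A])^{\mathbb{N}_0}$ by the same formulas for all $i\ge 0$. Hesselholt constructs abelian groups $W_n(A)$ and a factorization $A^n\xrightarrow{q_n}W_n(A)\xrightarrow{\overline\omega}(A/[A,A])^n$ of $\omega$ with $q_n$ a surjective map of sets and $\overline\omega$ an additive homomorphism that is injective when $A/[A,A]$ is $p$-torsion free. For $A=\mathbb{Z}\{X,Y\}$ the group $A/[A,A]$ is torsion free, so $W_n(A)$ is identified with the image of $\omega$ in $(A/[A,A])^n$ (which is a subgroup). $W(A)=\varprojlim_n W_n(A)$ along the truncation maps, with the inverse limit topology, each $W_n(A)$ being discrete. There is a surjective map $q:A^{\mathbb{N}_0}\to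 W(A)$ and a homomorphism (the ghost map) $\overline\omega:W(A)\to(A/[A,A])^{\mathbb{N}_0}$ with $\overline\omega\circ q=\omega$. The Verschiebung $V:W(A)\to W(A)$ is the additive homomorphism with $V(q(a_0,a_1,\dots))=q(0,a_0,a_1,\dots)$, and the Teichmüller map $A\to W(A)$ is $\langle a\rangle=q(a,0,0,\dots)$. Cuntz–Deninger's ring $E(A)$. For a ring $B$, give $B^{\mathbb{N}_0}$ the componentwise ring structure and the product topology with $B$ discrete. Put $V(b_0,b_1,\dots)=p(0,b_0,b_1,\dots)$ and $\langle b\rangle=(b,b^p,b^{p^2},\dots)$. For $B$ itself or a two-sided ideal $I\subset B$ let $X(B)$, respectively $X(I)$, be the closed additive subgroup of $B^{\mathbb{N}_0}$ generated by all $V^m(\langle b_1\rangle\cdots\langle b_r\rangle)$ with $m\in\mathbb{N}_0$, $r\ge1$ and all $b_i\in B$, respectively all $b_i\in I$. $X(B)$ is a ring and $X(I)$ is an ideal of it. Let $\mathbb{Z}A$ be the monoid algebra of the multiplicative monoid of $A$ (formal finite sums $\sum n_r[r]$, $r\in A$), and let $I$ be the kernel of the ring epimorphism $\mathbb{Z}A\to A$, $[r]\mapsto r$. Then $E(A)=X(\mathbb{Z}A)/X(I)$, a Hausdorff topological ring with the quotient topology. It carries the continuous additive map $V$ induced by $V$ on $(\mathbb{Z}A)^{\mathbb{N}_0}$ and the Teichmüller map $\langle a\rangle=([a],[a]^p,[a]^{p^2},\dots)\bmod X(I)$. $HH_0(E(A))=E(A)/\overline{[E(A),E(A)]}$ is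 the quotient by the closure of the additive commutator subgroup, with the quotient topology. On $HH_0(E(A))$, $V: HH_0(E(A))\to HH_0(E(A))$ is the additive group homomorphism induced by $V$ on $E(A)$, and $\langle\ \rangle: A\to HH_0(E(A))$ is the Teichmüller map induced by that of $E(A)$.
   Formalization: V on E(A) does not descend to HH_0(E(A)), so Ψ∘V=V∘Ψ is read as: for each w some x in E(A) has Ψ(w)=[x] and Ψ(Vw)=[Vx], which any induced V would satisfy; E(A) is taken as a topological group whose commutators are the classes of xy-yx. *)

theory Defs
  imports
    "HOL-Analysis.Abstract_Topology"
    "HOL-Analysis.Function_Topology"
    "HOL-Algebra.AbelCoset"
    "HOL-Algebra.Generated_Groups"
    "HOL-Algebra.Product_Groups"
    "HOL-Library.Function_Algebras"
    "HOL-Library.Poly_Mapping"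
    "HOL-Computational_Algebra.Primes"
begin

section \<open>Monoid algebras over the integers\<close>

text \<open>
  For an additively written, not necessarily commutative, monoid \<open>M\<close> the type
  \<open>M \<Rightarrow>\<^sub>0 int\<close> with the convolution product of \<^theory>\<open>HOL-Library.Poly_Mapping\<close> is the integral
  monoid algebra of \<open>M\<close>. Words under concatenation and the multiplicative monoid of a ring are
  wrapped in types of their own so that they can be written additively.
\<close>

datatype 'a free_mon = Word (letters: "'a list")

instantiation free_mon :: (type) monoid_add
begin
definition "0 = Word []"
definition "v + w = Word (letters v @ letters w)"
instance
  by standard (simp_all add: zero_free_mon_def plus_free_mon_def)
end

datatype gen = GenX | GenY

type_synonym ZXY = "gen free_mon \<Rightarrow>\<^sub>0 int"

datatype 'a mult_mon = Mult (unMult: 'a)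

instantiation mult_mon :: (monoid_mult) monoid_add
begin
definition "0 = Mult 1"
definition "r + s = Mult (unMult r * unMult s)"
instance
  by standard (simp_all add: zero_mult_mon_def plus_mult_mon_def mult.assoc)
end

type_synonym 'a mon_alg = "'a mult_mon \<Rightarrow>\<^sub>0 int"

definition mon_alg_basis :: "'a \<Rightarrow> 'a mon_alg"
  where "mon_alg_basis r = Poly_Mapping.single (Mult r) 1"

definition mon_alg_eval :: "'a::ring_1 mon_alg \<Rightarrow> 'a"
  where "mon_alg_eval x = (\<Sum>r\<in>Poly_Mapping.keys x. of_int (Poly_Mapping.lookup x r) * unMult r)"

definition mon_alg_kernel :: "'a::ring_1 mon_alg set"
  where "mon_alg_kernel = {x. mon_alg_eval x = 0}"


section \<open>Rings, commutators, quotients\<close>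

definition type_ring :: "'a::ring_1 ring"
  where "type_ring = \<lparr>carrier = UNIV, monoid.mult = (*), one = 1, zero = 0, add = (+)\<rparr>"

lemma ring_type_ring: "ring (type_ring :: 'a::ring_1 ring)"
proof -
  have "\<exists>y. x + y = 0" for x :: 'a
    using add.right_inverse by blast
  moreover have "\<exists>y. y + x = 0 \<and> x + y = 0" for x :: 'a
    by (rule exI[of _ "- x"]) simp
  ultimately show ?thesis
    unfolding type_ring_def by unfold_locales (auto simp: algebra_simps Units_def)
qed

definition commutator_subgroup :: "('a, 'b) ring_scheme \<Rightarrow> 'a set"
  where "commutator_subgroup R = generate (add_monoid R)
    {x \<otimes>\<^bsub>R\<^esub> y \<ominus>\<^bsub>R\<^esub> y \<otimes>\<^bsub>R\<^esub> x | x y. x \<in> carrier R \<and> y \<in> carrier R}"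

text \<open>
  The map induced on \<open>G Mod N\<close> by an endomorphism \<open>f\<close> of \<open>G\<close> with \<open>f ` N \<subseteq> N\<close>.
\<close>

definition induced_map :: "('a, 'b) monoid_scheme \<Rightarrow> 'a set \<Rightarrow> ('a \<Rightarrow> 'a) \<Rightarrow> 'a set \<Rightarrow> 'a set"
  where "induced_map G N f C = N <#>\<^bsub>G\<^esub> f ` C"

lemma induced_map_r_coset:
  assumes "Group.group G" "subgroup N G" "f \<in> hom G G" "f ` N \<subseteq> N" "x \<in> carrier G"
  shows "induced_map G N f (N #>\<^bsub>G\<^esub> x) = N #>\<^bsub>G\<^esub> f x"
proof -
  interpret Group.group G by fact
  interpret N: subgroup N G by fact
  have fx: "f x \<in> carrier G" using assms by (auto simp: hom_def)
  have eq: "f (n \<otimes>\<^bsub>G\<^esub> x) = f n \<otimes>\<^bsub>G\<^esub> f x" if "n \<in> N" for n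
    using that assms(3,5) by (simp add: hom_mult N.mem_carrier)
  show ?thesis
  proof (intro equalityI subsetI)
    fix y assume "y \<in> induced_map G N f (N #>\<^bsub>G\<^esub> x)"
    then obtain m n where mn: "m \<in> N" "n \<in> N" "y = m \<otimes>\<^bsub>G\<^esub> f (n \<otimes>\<^bsub>G\<^esub> x)"
      by (auto simp: induced_map_def set_mult_def r_coset_def)
    have "f n \<in> N" using mn(2) assms(4) by auto
    then have "y = (m \<otimes>\<^bsub>G\<^esub> f n) \<otimes>\<^bsub>G\<^esub> f x"
      using mn eq fx by (simp add: m_assoc N.mem_carrier)
    then show "y \<in> N #>\<^bsub>G\<^esub> f x"
      using mn \<open>f n \<in> N\<close> by (auto simp: r_coset_def)
  next
    fix y assume "y \<in> N #>\<^bsub>G\<^esub> f x"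
    then obtain m where "m \<in> N" "y = m \<otimes>\<^bsub>G\<^esub> f x" by (auto simp: r_coset_def)
    moreover have "x \<in> N #>\<^bsub>G\<^esub> x"
      using assms(5) N.one_closed by (force simp: r_coset_def)
    ultimately show "y \<in> induced_map G N f (N #>\<^bsub>G\<^esub> x)"
      by (auto simp: induced_map_def set_mult_def)
  qed
qed

definition quotient_topology :: "'a topology \<Rightarrow> ('a \<Rightarrow> 'b) \<Rightarrow> 'b topology"
  where "quotient_topology T f =
    topology (\<lambda>U. U \<subseteq> f ` topspace T \<and> openin T {x \<in> topspace T. f x \<in> U})"

lemma openin_quotient_topology:
  "openin (quotient_topology T f) U \<longleftrightarrow>
     U \<subseteq> f ` topspace T \<and> openin T {x \<in> topspace T. f x \<in> U}"
proof -
  have "istopology (\<lambda>U. U \<subseteq> f ` topspace T \<and> openin T {x \<in> topspace T. f x \<in> U})"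
  proof -
    have "{x \<in> topspace T. f x \<in> U \<inter> V} =
        {x \<in> topspace T. f x \<in> U} \<inter> {x \<in> topspace T. f x \<in> V}" for U V
      by auto
    moreover have "{x \<in> topspace T. f x \<in> \<Union>\<K>} = (\<Union>K\<in>\<K>. {x \<in> topspace T. f x \<in> K})" for \<K>
      by auto
    ultimately show ?thesis
      unfolding istopology_def by (auto simp: Sup_le_iff intro!: openin_Union)
  qed
  then show ?thesis
    by (simp add: quotient_topology_def)
qed

lemma quotient_map_quotient_topology: "quotient_map T (quotient_topology T f) f"
proof -
  have "topspace (quotient_topology T f) = f ` topspace T"
  proof (rule antisym)
    show "topspace (quotient_topology T f) \<subseteq> f ` topspace T"
      using openin_topspace[of "quotient_topology T f"] openin_quotient_topology by metis
    have "{x \<in> topspace T. f x \<in> f ` topspace T} = topspace T" by auto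
    then show "f ` topspace T \<subseteq> topspace (quotient_topology T f)"
      by (intro openin_subset) (simp add: openin_quotient_topology)
  qed
  then show ?thesis
    by (auto simp: quotient_map_def openin_quotient_topology)
qed


section \<open>Hesselholt's group of Witt vectors\<close>

definition A_ab :: "'a::ring_1 set monoid"
  where "A_ab = add_monoid type_ring Mod commutator_subgroup type_ring"

definition ab_class :: "'a::ring_1 \<Rightarrow> 'a set"
  where "ab_class x = commutator_subgroup type_ring +>\<^bsub>type_ring\<^esub> x"

definition omega :: "nat \<Rightarrow> nat \<Rightarrow> (nat \<Rightarrow> 'a::ring_1) \<Rightarrow> 'a"
  where "omega p i a = (\<Sum>j\<le>i. of_nat p ^ j * a j ^ (p ^ (i - j)))"

definition omega_trunc :: "nat \<Rightarrow> nat \<Rightarrow> (nat \<Rightarrow> 'a::ring_1) \<Rightarrow> nat \<Rightarrow> 'a set"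
  where "omega_trunc p n a = (\<lambda>i\<in>{..<n}. ab_class (omega p i a))"

text \<open>
  \<open>Witt_trunc p n\<close> is the image of \<open>\<omega>\<close> in the \<open>n\<close>-fold power of \<open>A/[A,A]\<close>. It agrees with Hesselholt's
  \<open>W\<^sub>n(A)\<close> only if \<open>A/[A,A]\<close> has no \<open>p\<close>-torsion. The argument of \<^const>\<open>omega_trunc\<close> is a full sequence,
  of which only the first \<open>n\<close> entries matter.
\<close>

definition Witt_trunc :: "nat \<Rightarrow> nat \<Rightarrow> (nat \<Rightarrow> 'a::ring_1 set) monoid"
  where "Witt_trunc p n = (product_group {..<n} (\<lambda>_. A_ab)) \<lparr>carrier := range (omega_trunc p n)\<rparr>"

definition Witt :: "nat \<Rightarrow> (nat \<Rightarrow> nat \<Rightarrow> 'a::ring_1 set) monoid"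
  where "Witt p = (product_group {1..} (Witt_trunc p))
    \<lparr>carrier := {w \<in> \<Pi>\<^sub>E n\<in>{1..}. carrier (Witt_trunc p n).
                   \<forall>n\<ge>1. restrict (w (Suc n)) {..<n} = w n}\<rparr>"

definition Witt_topology :: "nat \<Rightarrow> (nat \<Rightarrow> nat \<Rightarrow> 'a::ring_1 set) topology"
  where "Witt_topology p = subtopology
    (product_topology (\<lambda>n. discrete_topology (carrier (Witt_trunc p n))) {1..}) (carrier (Witt p))"

definition Witt_q :: "nat \<Rightarrow> (nat \<Rightarrow> 'a::ring_1) \<Rightarrow> nat \<Rightarrow> nat \<Rightarrow> 'a set"
  where "Witt_q p a = (\<lambda>n\<in>{1..}. omega_trunc p n a)"

text \<open>
  Since \<open>\<omega>\<^sub>0(0,a\<^sub>0,\<dots>) = 0\<close> and \<open>\<omega>\<^sub>i\<^sub>+\<^sub>1(0,a\<^sub>0,\<dots>) = p \<omega>\<^sub>i(a\<^sub>0,\<dots>)\<close>, the Verschiebung of \<open>q(a)\<close> does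
  not depend on the choice of \<open>a\<close>; see \<open>Witt_V_q\<close> below.
\<close>

definition Witt_V :: "nat \<Rightarrow> (nat \<Rightarrow> nat \<Rightarrow> 'a::ring_1 set) \<Rightarrow> nat \<Rightarrow> nat \<Rightarrow> 'a set"
  where "Witt_V p w = (THE v. \<exists>a. w = Witt_q p a \<and> v = Witt_q p (case_nat 0 a))"

definition Witt_teich :: "nat \<Rightarrow> 'a::ring_1 \<Rightarrow> nat \<Rightarrow> nat \<Rightarrow> 'a set"
  where "Witt_teich p a = Witt_q p (case_nat a (\<lambda>_. 0))"

lemma Witt_q_in_carrier: "Witt_q p a \<in> carrier (Witt p)"
  by (auto simp: Witt_q_def Witt_def Witt_trunc_def omega_trunc_def fun_eq_iff)

lemma omega_shift:
  "omega p 0 (case_nat 0 a) = 0"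
  "omega p (Suc i) (case_nat 0 a) = of_nat p * omega p i a" if "p > 0"
  using that
  by (simp_all add: omega_def zero_power sum.atMost_Suc_shift sum_distrib_left mult.assoc
      del: sum.atMost_Suc)

lemma subgroup_commutator_subgroup:
  "subgroup (commutator_subgroup type_ring) (add_monoid (type_ring :: 'a::ring_1 ring))"
proof -
  interpret ring "type_ring :: 'a ring" by (rule ring_type_ring)
  show ?thesis
    unfolding commutator_subgroup_def
    by (rule add.generate_is_subgroup) (auto simp: type_ring_def)
qed

lemma add_monoid_type_ring:
  "add_monoid (type_ring :: 'a::ring_1 ring) = \<lparr>carrier = UNIV, monoid.mult = (+), one = 0\<rparr>"
  by (simp add: type_ring_def)

lemma commutator_subgroup_add:
  fixes x y :: "'a::ring_1"
  assumes "x \<in> commutator_subgroup type_ring" "y \<in> commutator_subgroup type_ring"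
  shows "x + y \<in> commutator_subgroup type_ring"
  using subgroup.m_closed[OF subgroup_commutator_subgroup assms]
  by (simp add: type_ring_def)

lemma commutator_subgroup_zero: "(0 :: 'a::ring_1) \<in> commutator_subgroup type_ring"
  using subgroup.one_closed[OF subgroup_commutator_subgroup] by (auto simp: type_ring_def)

lemma commutator_subgroup_of_nat_mult:
  fixes x :: "'a::ring_1"
  assumes "x \<in> commutator_subgroup type_ring"
  shows "of_nat k * x \<in> commutator_subgroup type_ring"
  by (induction k)
    (simp_all add: commutator_subgroup_zero commutator_subgroup_add assms distrib_right)

lemma ab_class_eq_iff:
  fixes x y :: "'a::ring_1"
  shows "ab_class x = ab_class y \<longleftrightarrow> x - y \<in> commutator_subgroup type_ring"
proof
  assume "ab_class x = ab_class y"
  moreover have "x \<in> ab_class x"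
    using commutator_subgroup_zero
    by (force simp: ab_class_def a_r_coset_def r_coset_def type_ring_def)
  ultimately have "x \<in> ab_class y" by simp
  then show "x - y \<in> commutator_subgroup type_ring"
    by (auto simp: ab_class_def a_r_coset_def r_coset_def type_ring_def)
next
  interpret ring "type_ring :: 'a ring" by (rule ring_type_ring)
  assume d: "x - y \<in> commutator_subgroup (type_ring :: 'a ring)"
  have "x \<in> ab_class y"
    unfolding ab_class_def a_r_coset_def r_coset_def add_monoid_type_ring
    using d by (auto intro!: bexI[of _ "x - y"])
  then show "ab_class x = ab_class y"
    unfolding ab_class_def a_r_coset_def
    by (intro add.repr_independence[symmetric] subgroup_commutator_subgroup)
      (auto simp: type_ring_def)
qed

lemma Witt_V_q:
  assumes "p > 0"
  shows "Witt_V p (Witt_q p a) = Witt_q p (case_nat 0 a)"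
proof -
  have "Witt_q p (case_nat 0 b) = Witt_q p (case_nat 0 a)" if eq: "Witt_q p a = Witt_q p b" for b
  proof -
    have cls: "ab_class (omega p i a) = ab_class (omega p i b)" for i
    proof -
      have "Witt_q p a (Suc i) i = Witt_q p b (Suc i) i" using eq by simp
      then show ?thesis by (simp add: Witt_q_def omega_trunc_def)
    qed
    have "ab_class (omega p i (case_nat 0 b)) = ab_class (omega p i (case_nat 0 a))" for i
    proof (cases i)
      case 0
      then show ?thesis using assms by (simp add: omega_shift)
    next
      case (Suc j)
      have "of_nat p * (omega p j b - omega p j a) \<in> commutator_subgroup type_ring"
        using cls[of j] by (intro commutator_subgroup_of_nat_mult) (metis ab_class_eq_iff)
      then show ?thesis
        using assms Suc by (simp add: omega_shift ab_class_eq_iff right_diff_distrib)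
    qed
    then show ?thesis by (simp add: Witt_q_def omega_trunc_def)
  qed
  then show ?thesis
    unfolding Witt_V_def by (intro the_equality) blast+
qed


section \<open>The ring \<open>E(A)\<close> of Cuntz and Deninger\<close>

definition seq_topology :: "(nat \<Rightarrow> 'b) topology"
  where "seq_topology = product_topology (\<lambda>_. discrete_topology UNIV) UNIV"

definition seq_V :: "nat \<Rightarrow> (nat \<Rightarrow> 'b::ring_1) \<Rightarrow> nat \<Rightarrow> 'b"
  where "seq_V p b = case_nat 0 (\<lambda>n. of_nat p * b n)"

definition seq_teich :: "nat \<Rightarrow> 'b::ring_1 \<Rightarrow> nat \<Rightarrow> 'b"
  where "seq_teich p b = (\<lambda>n. b ^ (p ^ n))"

text \<open>
  \<open>CD_X p S\<close> is used for \<open>S = UNIV\<close> and for ideals \<open>S\<close>; sums and products of sequences are pointwise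
  (\<^theory>\<open>HOL-Library.Function_Algebras\<close>).
\<close>

definition CD_X :: "nat \<Rightarrow> 'b::ring_1 set \<Rightarrow> (nat \<Rightarrow> 'b) set"
  where "CD_X p S = (\<lambda>H. subgroup H (add_monoid type_ring) \<and> closedin seq_topology H) hull
    {(seq_V p ^^ m) (prod_list (map (seq_teich p) bs)) | m bs. bs \<noteq> [] \<and> set bs \<subseteq> S}"

definition CD_X_group :: "nat \<Rightarrow> (nat \<Rightarrow> 'b::ring_1) monoid"
  where "CD_X_group p = (add_monoid type_ring) \<lparr>carrier := CD_X p UNIV\<rparr>"

text \<open>
  \<open>CD_E p\<close> is the additive group of \<open>E(A) = X(\<int>A)/X(I)\<close>. Since products in \<open>E(A)\<close> are products of
  representatives, the commutator of the classes of \<open>x\<close> and \<open>y\<close> is the class of \<open>xy - yx\<close>; the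
  multiplication enters only through \<open>CD_E_commutators\<close>, which is written in this form so as not to
  depend on \<open>X(I)\<close> being an ideal.
\<close>

definition CD_E :: "nat \<Rightarrow> (nat \<Rightarrow> 'a::ring_1 mon_alg) set monoid"
  where "CD_E p = CD_X_group p Mod CD_X p mon_alg_kernel"

definition CD_E_class :: "nat \<Rightarrow> (nat \<Rightarrow> 'a::ring_1 mon_alg) \<Rightarrow> (nat \<Rightarrow> 'a mon_alg) set"
  where "CD_E_class p x = CD_X p mon_alg_kernel #>\<^bsub>CD_X_group p\<^esub> x"

definition CD_E_topology :: "nat \<Rightarrow> (nat \<Rightarrow> 'a::ring_1 mon_alg) set topology"
  where "CD_E_topology p = quotient_topology (subtopology seq_topology (CD_X p UNIV)) (CD_E_class p)"

definition CD_E_V :: "nat \<Rightarrow> (nat \<Rightarrow> 'a::ring_1 mon_alg) set \<Rightarrow> (nat \<Rightarrow> 'a mon_alg) set"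
  where "CD_E_V p = induced_map (CD_X_group p) (CD_X p mon_alg_kernel) (seq_V p)"

definition CD_E_teich :: "nat \<Rightarrow> 'a::ring_1 \<Rightarrow> (nat \<Rightarrow> 'a mon_alg) set"
  where "CD_E_teich p a = CD_E_class p (seq_teich p (mon_alg_basis a))"

definition CD_E_commutators :: "nat \<Rightarrow> (nat \<Rightarrow> 'a::ring_1 mon_alg) set set"
  where "CD_E_commutators p = generate (CD_E p)
    {CD_E_class p (x * y - y * x) | x y. x \<in> CD_X p UNIV \<and> y \<in> CD_X p UNIV}"

lemma subgroup_CD_X: "subgroup (CD_X p S) (add_monoid (type_ring :: (nat \<Rightarrow> 'b::ring_1) ring))"
proof -
  interpret ring "type_ring :: (nat \<Rightarrow> 'b) ring" by (rule ring_type_ring)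
  have "subgroup UNIV (add_monoid (type_ring :: (nat \<Rightarrow> 'b) ring))"
    using add.subgroup_self by (simp add: type_ring_def)
  moreover have "closedin seq_topology (UNIV :: (nat \<Rightarrow> 'b) set)"
    using closedin_topspace[of "seq_topology :: (nat \<Rightarrow> 'b) topology"]
    by (simp add: seq_topology_def)
  ultimately show ?thesis
    unfolding CD_X_def hull_def by (intro add.subgroups_Inter) auto
qed

lemma closedin_CD_X: "closedin seq_topology (CD_X p (S :: 'b::ring_1 set))"
proof -
  interpret ring "type_ring :: (nat \<Rightarrow> 'b) ring" by (rule ring_type_ring)
  have "subgroup UNIV (add_monoid (type_ring :: (nat \<Rightarrow> 'b) ring))"
    using add.subgroup_self by (simp add: type_ring_def)
  moreover have "closedin seq_topology (UNIV :: (nat \<Rightarrow> 'b) set)"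
    using closedin_topspace[of "seq_topology :: (nat \<Rightarrow> 'b) topology"]
    by (simp add: seq_topology_def)
  ultimately show ?thesis
    unfolding CD_X_def hull_def by (intro closedin_Inter) auto
qed

lemma continuous_map_seq_V: "continuous_map seq_topology seq_topology (seq_V p)"
  unfolding seq_topology_def continuous_map_componentwise_UNIV
proof
  fix k
  show "continuous_map (product_topology (\<lambda>_. discrete_topology UNIV) UNIV) (discrete_topology UNIV)
    (\<lambda>x. seq_V p x k)"
  proof (cases k)
    case 0
    then show ?thesis by (simp add: seq_V_def)
  next
    case (Suc j)
    have "continuous_map (product_topology (\<lambda>_. discrete_topology UNIV) UNIV)
        (discrete_topology UNIV) ((\<lambda>b. of_nat p * b) \<circ> (\<lambda>x. x j))"
      by (rule continuous_map_compose[OF continuous_map_product_projection]) auto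
    then show ?thesis by (simp add: Suc seq_V_def o_def)
  qed
qed

lemma seq_V_add: "seq_V p (x + y) = seq_V p x + seq_V p y"
  by (auto simp: seq_V_def fun_eq_iff distrib_left split: nat.split)

lemma seq_V_CD_X:
  fixes S :: "'b::ring_1 set"
  assumes "x \<in> CD_X p S"
  shows "seq_V p x \<in> CD_X p S"
proof -
  let ?G = "add_monoid (type_ring :: (nat \<Rightarrow> 'b) ring)"
  let ?H = "{x. seq_V p x \<in> CD_X p S}"
  interpret ring "type_ring :: (nat \<Rightarrow> 'b) ring" by (rule ring_type_ring)
  have hom: "seq_V p \<in> hom ?G ?G"
    by (auto simp: hom_def type_ring_def seq_V_add)
  have V: "group_hom ?G ?G (seq_V p)"
    by (intro group_hom.intro group_hom_axioms.intro add.group_axioms hom)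
  have "subgroup ?H ?G"
  proof (rule group.subgroupI)
    show "Group.group ?G" by (rule add.group_axioms)
    show "?H \<subseteq> carrier ?G" by (simp add: type_ring_def)
    have "\<one>\<^bsub>?G\<^esub> \<in> ?H"
      using subgroup.one_closed[OF subgroup_CD_X[of p S]] group_hom.hom_one[OF V] by simp
    then show "?H \<noteq> {}" by blast
    show "inv\<^bsub>?G\<^esub> x \<in> ?H" if "x \<in> ?H" for x
    proof -
      have "x \<in> carrier ?G" by (simp add: type_ring_def)
      then have "seq_V p (inv\<^bsub>?G\<^esub> x) = inv\<^bsub>?G\<^esub> (seq_V p x)"
        by (rule group_hom.hom_inv[OF V])
      moreover have "inv\<^bsub>?G\<^esub> (seq_V p x) \<in> CD_X p S"
        using that by (intro subgroup.m_inv_closed[OF subgroup_CD_X]) simp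
      ultimately show ?thesis by simp
    qed
    show "x \<otimes>\<^bsub>?G\<^esub> y \<in> ?H" if "x \<in> ?H" "y \<in> ?H" for x y
      using subgroup.m_closed[OF subgroup_CD_X[of p S]] that
      by (simp add: type_ring_def seq_V_add)
  qed
  moreover have "closedin seq_topology ?H"
    using closedin_continuous_map_preimage[OF continuous_map_seq_V[of p] closedin_CD_X[of p S]]
    by (simp add: seq_topology_def)
  moreover have "{(seq_V p ^^ m) (prod_list (map (seq_teich p) bs)) | m bs.
      bs \<noteq> [] \<and> set bs \<subseteq> S} \<subseteq> ?H"
  proof clarify
    fix m and bs :: "'b list" assume "bs \<noteq> []" "set bs \<subseteq> S"
    then have "(seq_V p ^^ Suc m) (prod_list (map (seq_teich p) bs)) \<in> CD_X p S"
      unfolding CD_X_def by (intro hull_inc) blast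
    then show "seq_V p ((seq_V p ^^ m) (prod_list (map (seq_teich p) bs))) \<in> CD_X p S"
      by simp
  qed
  ultimately have "CD_X p S \<subseteq> ?H"
    unfolding CD_X_def[of p S] by (intro hull_minimal) auto
  with assms show ?thesis by blast
qed

lemma CD_E_V_class:
  fixes x :: "nat \<Rightarrow> 'a::ring_1 mon_alg"
  assumes "x \<in> CD_X p UNIV"
  shows "CD_E_V p (CD_E_class p x) = CD_E_class p (seq_V p x)"
proof -
  interpret ring "type_ring :: (nat \<Rightarrow> 'a mon_alg) ring" by (rule ring_type_ring)
  have grp: "Group.group (CD_X_group p :: (nat \<Rightarrow> 'a mon_alg) monoid)"
    unfolding CD_X_group_def by (rule add.subgroup_imp_group[OF subgroup_CD_X])
  have mono: "CD_X p S \<subseteq> CD_X p (UNIV :: 'a mon_alg set)" for S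
    unfolding CD_X_def by (rule hull_mono) blast
  have sub: "subgroup (CD_X p mon_alg_kernel) (CD_X_group p :: (nat \<Rightarrow> 'a mon_alg) monoid)"
    unfolding CD_X_group_def
    by (rule add.subgroup_incl[OF subgroup_CD_X subgroup_CD_X mono])
  show ?thesis
    unfolding CD_E_V_def CD_E_class_def
  proof (rule induced_map_r_coset[OF grp sub])
    show "seq_V p \<in> hom (CD_X_group p) (CD_X_group p :: (nat \<Rightarrow> 'a mon_alg) monoid)"
      by (auto simp: hom_def CD_X_group_def type_ring_def seq_V_add seq_V_CD_X)
    show "seq_V p ` CD_X p mon_alg_kernel \<subseteq> CD_X p (mon_alg_kernel :: 'a mon_alg set)"
      by (auto intro: seq_V_CD_X)
    show "x \<in> carrier (CD_X_group p)"
      using assms by (simp add: CD_X_group_def)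
  qed
qed


section \<open>The group \<open>HH\<^sub>0(E(A))\<close>\<close>

definition HH0_E :: "nat \<Rightarrow> (nat \<Rightarrow> 'a::ring_1 mon_alg) set set monoid"
  where "HH0_E p = CD_E p Mod (Abstract_Topology.closure_of (CD_E_topology p) (CD_E_commutators p))"

definition HH0_E_class :: "nat \<Rightarrow> (nat \<Rightarrow> 'a::ring_1 mon_alg) set \<Rightarrow> (nat \<Rightarrow> 'a mon_alg) set set"
  where "HH0_E_class p x =
    (Abstract_Topology.closure_of (CD_E_topology p) (CD_E_commutators p)) #>\<^bsub>CD_E p\<^esub> x"

definition HH0_E_topology :: "nat \<Rightarrow> (nat \<Rightarrow> 'a::ring_1 mon_alg) set set topology"
  where "HH0_E_topology p = quotient_topology (CD_E_topology p) (HH0_E_class p)"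

text \<open>
  The graph of the map induced on \<open>HH\<^sub>0(E(A))\<close> by \<open>V\<close>: \<open>C\<close> is sent to \<open>D\<close> if \<open>C\<close> is the class of some
  \<open>x\<close> and \<open>D\<close> the class of \<open>V x\<close>. It is a relation because \<open>V\<close> need not map \<open>[E(A),E(A)]\<close> to its
  closure: for \<open>A = \<int>{X,Y}\<close>, the image of \<open>V [\<langle>X\<rangle>,\<langle>Y\<rangle>]\<close> in \<open>A\<^sup>\<nat>\<close> has \<open>p(XY - YX)\<close> at index \<open>1\<close>, whereas
  the part linear in \<open>X\<close> and in \<open>Y\<close> of a commutator at index \<open>1\<close> lies in \<open>p\<^sup>2\<int>(XY - YX)\<close>. The graph of
  any map on \<open>HH\<^sub>0(E(A))\<close> induced by \<open>V\<close> would be contained in the relation, so requiring only the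
  relation asks less of \<open>\<Psi>\<close>.
\<close>

definition HH0_E_V_graph ::
    "nat \<Rightarrow> (nat \<Rightarrow> 'a::ring_1 mon_alg) set set \<Rightarrow> (nat \<Rightarrow> 'a mon_alg) set set \<Rightarrow> bool"
  where "HH0_E_V_graph p C D \<longleftrightarrow>
    (\<exists>x \<in> carrier (CD_E p). C = HH0_E_class p x \<and> D = HH0_E_class p (CD_E_V p x))"

definition HH0_E_teich :: "nat \<Rightarrow> 'a::ring_1 \<Rightarrow> (nat \<Rightarrow> 'a mon_alg) set set"
  where "HH0_E_teich p a = HH0_E_class p (CD_E_teich p a)"

end

theory Submission
  imports Defs
begin

text \<open>
  The cyclic coefficient \<open>\<tau>\<close> of \<open>X\<^sup>pY\<^sup>p\<close>, i.e. the sum of the coefficients of all cyclic rotations of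
  this word, is a trace on \<open>\<int>{X,Y}\<close>. Evaluating \<open>\<int>A \<rightarrow> A\<close> at index \<open>1\<close> and applying \<open>\<tau>\<close> modulo \<open>p\<close>
  kills \<open>X(I)\<close> and commutators, so it gives a continuous homomorphism \<open>HH\<^sub>0(E(A)) \<rightarrow> \<int>/p\<close>. It vanishes
  on the image of \<open>V\<close>, and on every \<open>\<langle>a\<rangle>\<close>: modulo \<open>p\<close> only \<open>p\<close>-th powers of words contribute to
  \<open>\<tau>(a\<^sup>p)\<close>, and no rotation of \<open>X\<^sup>pY\<^sup>p\<close> is one. Since \<open>q(a\<^sub>0, a\<^sub>1, \<dots>) = \<langle>a\<^sub>0\<rangle> + V q(a\<^sub>1, a\<^sub>2, \<dots>)\<close> and these
  elements are dense in \<open>W(A)\<close>, it vanishes on the image of any \<open>\<Psi>\<close> as in the theorem. But on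
  \<open>\<langle>X\<rangle>\<langle>Y\<rangle>\<close> its value is \<open>\<tau>(X\<^sup>pY\<^sup>p) = 1\<close>, so \<open>\<Psi>\<close> is not surjective.
\<close>

section \<open>Linear extension from a monoid to its integral monoid algebra\<close>

text \<open>Both evaluation in a ring and the cyclic coefficient are of this form.\<close>

definition lin_ext :: "('m \<Rightarrow> 'r::ring_1) \<Rightarrow> ('m \<Rightarrow>\<^sub>0 int) \<Rightarrow> 'r"
  where "lin_ext f x = (\<Sum>r\<in>Poly_Mapping.keys x. of_int (Poly_Mapping.lookup x r) * f r)"

lemma lin_ext_superset:
  assumes "finite S" "Poly_Mapping.keys x \<subseteq> S"
  shows "lin_ext f x = (\<Sum>r\<in>S. of_int (Poly_Mapping.lookup x r) * f r)"
  unfolding lin_ext_def using assms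
  by (intro sum.mono_neutral_left) (auto simp: in_keys_iff)

lemma lin_ext_zero [simp]: "lin_ext f 0 = 0"
  by (simp add: lin_ext_def)

lemma lin_ext_single [simp]: "lin_ext f (Poly_Mapping.single r n) = of_int n * f r"
  by (simp add: lin_ext_def)

lemma lin_ext_diff: "lin_ext f (x - y) = lin_ext f x - lin_ext f y"
proof -
  let ?S = "Poly_Mapping.keys x \<union> Poly_Mapping.keys y"
  have "Poly_Mapping.keys (x - y) \<subseteq> ?S"
    by (auto simp: in_keys_iff lookup_minus)
  then show ?thesis
    by (simp add: lin_ext_superset[of ?S] lookup_minus left_diff_distrib sum_subtractf)
qed

lemma lin_ext_uminus: "lin_ext f (- x) = - lin_ext f x"
  using lin_ext_diff[of f 0 x] by simp

lemma lin_ext_add: "lin_ext f (x + y) = lin_ext f x + lin_ext f y"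
  using lin_ext_diff[of f x "- y"] by (simp add: lin_ext_uminus)

text \<open>The basis elements generate the additive group, so closure under differences reaches
  every element.\<close>

lemma mon_alg_induct [case_names zero basis diff]:
  fixes x :: "'m \<Rightarrow>\<^sub>0 int"
  assumes "P 0" "\<And>r. P (Poly_Mapping.single r 1)" "\<And>x y. P x \<Longrightarrow> P y \<Longrightarrow> P (x - y)"
  shows "P x"
  using frag_induction[of x UNIV P] assms by auto

lemma lin_ext_mult:
  fixes f :: "'m::monoid_add \<Rightarrow> 'r::ring_1"
  assumes "\<And>r s. f (r + s) = f r * f s"
  shows "lin_ext f (x * y) = lin_ext f x * lin_ext f y"
proof (induction x rule: mon_alg_induct)
  case (basis r)
  show ?case
    by (induction y rule: mon_alg_induct)
      (simp_all add: mult_single assms lin_ext_diff right_diff_distrib)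
qed (simp_all add: lin_ext_diff left_diff_distrib)

text \<open>Both sides are additive in each factor, so comparing them on products of basis elements
  suffices.\<close>

lemma lin_ext_trace:
  fixes f :: "'m::monoid_add \<Rightarrow> 'r::ring_1"
  assumes "\<And>r s. f (r + s) = f (s + r)"
  shows "lin_ext f (x * y) = lin_ext f (y * x)"
proof (induction x rule: mon_alg_induct)
  case (basis r)
  show ?case
    by (induction y rule: mon_alg_induct)
      (simp_all add: mult_single assms[of r] lin_ext_diff right_diff_distrib left_diff_distrib)
qed (simp_all add: lin_ext_diff left_diff_distrib right_diff_distrib)

lemma single_sum_eq:
  "(\<Sum>r\<in>Poly_Mapping.keys x. Poly_Mapping.single r (Poly_Mapping.lookup x r)) = x"
proof (rule poly_mapping_eqI)
  fix k
  have "Poly_Mapping.lookup (\<Sum>r\<in>Poly_Mapping.keys x. Poly_Mapping.single r (Poly_Mapping.lookup x r)) k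
      = (\<Sum>r\<in>Poly_Mapping.keys x. if r = k then Poly_Mapping.lookup x r else 0)"
    unfolding lookup_sum by (intro sum.cong) (auto simp: lookup_single when_def)
  also have "\<dots> = Poly_Mapping.lookup x k"
    by (auto simp: in_keys_iff)
  finally show "Poly_Mapping.lookup (\<Sum>r\<in>Poly_Mapping.keys x. Poly_Mapping.single r (Poly_Mapping.lookup x r)) k
      = Poly_Mapping.lookup x k" .
qed

section \<open>Evaluation of the monoid algebra of a ring\<close>

lemma mon_alg_eval_lin_ext: "mon_alg_eval = lin_ext unMult"
  by (simp add: fun_eq_iff mon_alg_eval_def lin_ext_def)

lemma mon_alg_eval_mult: "mon_alg_eval (x * y) = mon_alg_eval x * mon_alg_eval y"
  unfolding mon_alg_eval_lin_ext by (rule lin_ext_mult) (simp add: plus_mult_mon_def)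

lemma mon_alg_eval_one [simp]: "mon_alg_eval 1 = 1"
  unfolding mon_alg_eval_lin_ext single_one[symmetric] lin_ext_single
  by (simp add: zero_mult_mon_def)

lemma mon_alg_eval_power: "mon_alg_eval (x ^ n) = mon_alg_eval x ^ n"
  by (induction n) (simp_all add: mon_alg_eval_mult)

lemma mon_alg_eval_basis [simp]: "mon_alg_eval (mon_alg_basis a) = a"
  by (simp add: mon_alg_eval_lin_ext mon_alg_basis_def)


section \<open>Traces of \<open>p\<close>-th powers\<close>

text \<open>Bezout: for nonzero \<open>a\<close> some multiple of \<open>a\<close> exceeds a
  multiple of \<open>b\<close> by one, and both iterates fix \<open>x\<close>.\<close>

lemma funpow_fixpoint_coprime:
  assumes "(g ^^ a) x = x" "(g ^^ b) x = x" "coprime a b" "inj g"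
  shows "g x = x"
proof (cases "a = 0")
  case True
  then show ?thesis using assms by simp
next
  case False
  obtain u v where "a * u = b * v + 1"
    using bezout_nat[OF False, of b] assms(3) by (auto simp: coprime_iff_gcd_eq_1)
  moreover have "(g ^^ (k * u)) x = x" if "(g ^^ k) x = x" for k u
    using that by (induction u) (simp_all add: funpow_add)
  ultimately have "(g ^^ (b * v + 1)) x = x" "(g ^^ (b * v)) x = x"
    using assms by metis+
  moreover have "(g ^^ (b * v + 1)) x = g ((g ^^ (b * v)) x)"
    by simp
  ultimately show ?thesis by metis
qed

text \<open>Without fixed points every orbit of \<open>g\<close> on \<open>L\<close> has exactly
  \<open>p\<close> elements, and \<open>F\<close> is constant on it. The induction removes one orbit
  at a time.\<close>

lemma dvd_sum_cyclic:
  fixes F :: "'b \<Rightarrow> int"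
  assumes p: "prime p" and fin: "finite L" and gL: "g ` L \<subseteq> L"
    and inj: "inj g" and gp: "\<And>x. x \<in> L \<Longrightarrow> (g ^^ p) x = x"
    and F: "\<And>x. x \<in> L \<Longrightarrow> F (g x) = F x"
    and nofix: "\<And>x. x \<in> L \<Longrightarrow> g x \<noteq> x"
  shows "int p dvd sum F L"
  using fin gL gp F nofix
proof (induction L rule: finite_psubset_induct)
  case (psubset L)
  show ?case
  proof (cases "L = {}")
    case False
    then obtain x where x: "x \<in> L" by blast
    have p0: "p > 0" using p prime_gt_0_nat by blast
    define O' where "O' = (\<lambda>i. (g ^^ i) x) ` {..<p}"
    have it: "(g ^^ i) x \<in> L" for i
      by (induction i) (use x psubset.prems(1) in auto)
    have "F ((g ^^ i) x) = F x" for i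
      by (induction i) (use it psubset.prems(3) in auto)
    moreover have injO: "inj_on (\<lambda>i. (g ^^ i) x) {..<p}"
    proof (rule linorder_inj_onI)
      fix i j assume ij: "i < j" "i \<in> {..<p}" "j \<in> {..<p}"
      show "(g ^^ i) x \<noteq> (g ^^ j) x"
      proof
        assume eq: "(g ^^ i) x = (g ^^ j) x"
        have "(g ^^ i) ((g ^^ (j - i)) x) = (g ^^ i) x"
          using eq ij(1) by (metis comp_apply funpow_add le_add_diff_inverse less_imp_le)
        then have "(g ^^ (j - i)) x = x"
          using inj_fn[OF inj] by (auto dest: injD)
        moreover have "coprime (j - i) p"
          using p ij by (metis coprime_commute diff_is_0_eq dvd_imp_le lessThan_iff less_imp_diff_less
              not_le prime_imp_coprime zero_less_diff)
        ultimately have "g x = x"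
          using funpow_fixpoint_coprime psubset.prems(2)[OF x] inj by metis
        then show False using psubset.prems(4)[OF x] by simp
      qed
    qed auto
    ultimately have sumO: "sum F O' = int p * F x"
      by (simp add: O'_def sum.reindex)
    have O'L: "O' \<subseteq> L" using it by (auto simp: O'_def)
    have xO: "x \<in> O'"
      unfolding O'_def by (rule image_eqI[of _ _ 0]) (use p0 in auto)
    \<comment> \<open>Since the orbit contains all preimages of its elements, its complement in
      \<open>L\<close> is again stable under \<open>g\<close>.\<close>
    have preO: "y \<in> O'" if y: "g y \<in> O'" for y
    proof -
      obtain i where i: "g y = (g ^^ i) x" "i < p"
        using y by (auto simp: O'_def)
      \<comment> \<open>The orbit closes up at \<open>p\<close>, so the predecessor of index 0 is
        \<open>p - 1\<close>.\<close>
      define j where "j = (if i = 0 then p - 1 else i - 1)"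
      have "g ((g ^^ j) x) = (g ^^ i) x"
      proof (cases "i = 0")
        case True
        have "g ((g ^^ j) x) = (g ^^ Suc j) x" by simp
        also have "Suc j = p" using True p0 by (simp add: j_def)
        finally show ?thesis using psubset.prems(2)[OF x] True by simp
      next
        case False
        have "g ((g ^^ j) x) = (g ^^ Suc j) x" by simp
        also have "Suc j = i" using False by (simp add: j_def)
        finally show ?thesis .
      qed
      then have "y = (g ^^ j) x" using i(1) inj by (metis injD)
      moreover have "j < p" using i(2) p0 by (auto simp: j_def)
      ultimately show ?thesis by (auto simp: O'_def)
    qed
    have "int p dvd sum F (L - O')"
    proof (rule psubset.IH)
      show "L - O' \<subset> L" using x xO by blast
      show "g ` (L - O') \<subseteq> L - O'" using psubset.prems(1) preO by auto
    qed (use psubset.prems in auto)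
    moreover have "sum F L = sum F (L - O') + sum F O'"
      using psubset.hyps O'L by (metis sum.subset_diff)
    ultimately show ?thesis using sumO by simp
  qed simp
qed

lemma power_sum_lists:
  fixes c :: "'i \<Rightarrow> 'r::ring_1"
  assumes "finite K"
  shows "(\<Sum>i\<in>K. c i) ^ n = (\<Sum>l | set l \<subseteq> K \<and> length l = n. prod_list (map c l))"
proof (induction n)
  case 0
  have "{l. set l \<subseteq> K \<and> length l = 0} = {[]}" by auto
  then show ?case by simp
next
  case (Suc n)
  let ?L = "\<lambda>n. {l. set l \<subseteq> K \<and> length l = n}"
  have "?L (Suc n) = (\<lambda>(i, l). i # l) ` (K \<times> ?L n)"
    by (auto simp: image_iff length_Suc_conv)
  moreover have "inj_on (\<lambda>(i, l). i # l) (K \<times> ?L n)"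
    by (auto simp: inj_on_def)
  ultimately have "(\<Sum>l\<in>?L (Suc n). prod_list (map c l))
      = (\<Sum>(i, l)\<in>K \<times> ?L n. c i * prod_list (map c l))"
    by (simp add: sum.reindex case_prod_unfold)
  also have "\<dots> = (\<Sum>i\<in>K. c i) * (\<Sum>l\<in>?L n. prod_list (map c l))"
    by (simp add: sum_product sum.cartesian_product)
  finally show ?case by (simp add: Suc.IH)
qed

lemma rotate1_fixed_imp_replicate:
  assumes "rotate1 l = l" "l \<noteq> []"
  shows "l = replicate (length l) (hd l)"
proof -
  obtain a m where l: "l = a # m" using assms(2) by (cases l) auto
  then have "m @ [a] = a # m" using assms(1) by simp
  then have "m = replicate (length m) a"
    by (induction m) (auto simp: Cons_eq_append_conv)
  then show ?thesis using l by simp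
qed

lemma funpow_rotate1_length: "(rotate1 ^^ length l) l = l"
  using rotate_id[of "length l" l] by (simp add: rotate_def)

text \<open>
  Expanding \<open>(\<Sum> c\<^sub>i)\<^sup>p\<close> into words of length \<open>p\<close>, the rotations of a non-constant word form an orbit
  of length \<open>p\<close>, on which the trace is constant.
\<close>

lemma trace_power_sum:
  fixes t :: "'r::ring_1 \<Rightarrow> int" and c :: "'i \<Rightarrow> 'r"
  assumes p: "prime p" and K: "finite K"
    and add: "\<And>x y. t (x + y) = t x + t y" and comm: "\<And>x y. t (x * y) = t (y * x)"
  shows "int p dvd t ((\<Sum>i\<in>K. c i) ^ p) - (\<Sum>i\<in>K. t (c i ^ p))"
proof -
  have p0: "p > 0" using p prime_gt_0_nat by blast
  let ?L = "{l. set l \<subseteq> K \<and> length l = p}"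
  let ?C = "(\<lambda>i. replicate p i) ` K"
  let ?F = "\<lambda>l. t (prod_list (map c l))"
  have finL: "finite ?L" by (rule finite_lists_length_eq[OF K])
  have t0: "t 0 = 0" using add[of 0 0] by simp
  have tsum: "t (sum h S) = (\<Sum>s\<in>S. t (h s))" for h :: "'i list \<Rightarrow> 'r" and S
    by (induction S rule: infinite_finite_induct) (simp_all add: t0 add)
  have rot: "?F (rotate1 l) = ?F l" for l
    by (cases l) (simp_all add: comm)
  have "int p dvd sum ?F (?L - ?C)"
  proof (rule dvd_sum_cyclic[OF p, where g = rotate1])
    show "finite (?L - ?C)" using finL by simp
    show "rotate1 ` (?L - ?C) \<subseteq> ?L - ?C"
    proof (rule image_subsetI, rule DiffI)
      fix l assume l: "l \<in> ?L - ?C"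
      then show "rotate1 l \<in> ?L" by simp
      show "rotate1 l \<notin> ?C"
      proof
        assume "rotate1 l \<in> ?C"
        \<comment> \<open>A constant list equals its own rotation, so injectivity of
          \<open>rotate1\<close> makes \<open>l\<close> constant.\<close>
        then obtain i where "i \<in> K" "rotate1 l = rotate1 (replicate p i)" by auto
        then show False using l injD[OF inj_rotate1, of l "replicate p i"] by blast
      qed
    qed
    show "(rotate1 ^^ p) l = l" if "l \<in> ?L - ?C" for l
      using that funpow_rotate1_length by blast
    show "rotate1 l \<noteq> l" if "l \<in> ?L - ?C" for l
    proof
      assume "rotate1 l = l"
      moreover have "l \<noteq> []" using that p0 by auto
      ultimately have "l = replicate p (hd l)" "hd l \<in> K"
        using that rotate1_fixed_imp_replicate[of l] hd_in_set[of l] by auto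
      then show False using that by blast
    qed
  qed (simp_all add: rot inj_rotate1)
  moreover have "sum ?F ?C = (\<Sum>i\<in>K. t (c i ^ p))"
  proof -
    have "inj_on (\<lambda>i. replicate p i) K"
      using p0 by (auto simp: inj_on_def)
    then show ?thesis by (simp add: sum.reindex)
  qed
  moreover have "t ((\<Sum>i\<in>K. c i) ^ p) = sum ?F (?L - ?C) + sum ?F ?C"
  proof -
    have "?C \<subseteq> ?L" by auto
    then show ?thesis
      using sum.subset_diff[of ?C ?L ?F] finL by (simp only: power_sum_lists[OF K] tsum)
  qed
  ultimately show ?thesis by simp
qed


section \<open>The cyclic coefficient of \<open>X\<^sup>pY\<^sup>p\<close>\<close>

definition XY_word :: "nat \<Rightarrow> gen list"
  where "XY_word p = replicate p GenX @ replicate p GenY"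

text \<open>\<open>of_bool\<close> counts each word once, although many \<open>n\<close> give the
  same rotation.\<close>

definition cyc_coeff :: "nat \<Rightarrow> ZXY \<Rightarrow> int"
  where "cyc_coeff p = lin_ext (\<lambda>w. of_bool (\<exists>n. letters w = rotate n (XY_word p)))"

lemma rotate_append_swap: "(\<exists>n. u @ v = rotate n z) \<longleftrightarrow> (\<exists>n. v @ u = rotate n z)"
  by (metis rotate_append rotate_rotate)

lemma cyc_coeff_comm: "cyc_coeff p (x * y) = cyc_coeff p (y * x)"
  unfolding cyc_coeff_def
proof (rule lin_ext_trace)
  fix r s :: "gen free_mon"
  show "of_bool (\<exists>n. letters (r + s) = rotate n (XY_word p))
      = (of_bool (\<exists>n. letters (s + r) = rotate n (XY_word p)) :: int)"
    using rotate_append_swap[of "letters r" "letters s"] by (simp add: plus_free_mon_def)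
qed

lemma cyc_coeff_add: "cyc_coeff p (x + y) = cyc_coeff p x + cyc_coeff p y"
  and cyc_coeff_diff: "cyc_coeff p (x - y) = cyc_coeff p x - cyc_coeff p y"
  and cyc_coeff_zero [simp]: "cyc_coeff p 0 = 0"
  by (simp_all add: cyc_coeff_def lin_ext_add lin_ext_diff)

lemma cyc_coeff_of_nat_mult: "cyc_coeff p (of_nat n * x) = int n * cyc_coeff p x"
  by (induction n) (simp_all add: cyc_coeff_add distrib_right)

text \<open>Rotating the \<open>k\<close>-th power of a word by one letter gives the
  \<open>k\<close>-th power of the rotated word.\<close>

lemma rotate_concat_replicate:
  "\<exists>w'. length w' = length w \<and> rotate n (concat (replicate k w)) = concat (replicate k w')"
proof (induction n)
  case (Suc n)
  then obtain w' where w': "length w' = length w"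
    "rotate n (concat (replicate k w)) = concat (replicate k w')" by blast
  have "rotate1 (concat (replicate k w')) = concat (replicate k (rotate1 w'))"
  proof (cases w')
    case (Cons a v)
    have "concat (replicate j (a # v)) @ [a] = a # concat (replicate j (v @ [a]))" for j
      by (induction j) simp_all
    then show ?thesis using Cons by (cases k) simp_all
  qed (induction k, simp_all)
  then show ?case using w' by (intro exI[of _ "rotate1 w'"]) (simp add: w')
qed auto

text \<open>Rotating back would make X^p Y^p itself the \<open>p\<close>-th power of a word. By
  length this word has two letters, hence it is XX, and Y never occurs.\<close>

lemma XY_word_not_power:
  assumes "p \<ge> 2"
  shows "concat (replicate p w) \<noteq> rotate n (XY_word p)"
proof
  assume eq: "concat (replicate p w) = rotate n (XY_word p)"
  \<comment> \<open>The complementary rotation, by the length minus the reduced \<open>n\<close>,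
    undoes the rotation by \<open>n\<close>.\<close>
  have "XY_word p = rotate (length (XY_word p) - n mod length (XY_word p)) (rotate n (XY_word p))"
    using assms
    by (smt (verit) XY_word_def append_is_Nil_conv le_add_diff_inverse2 length_greater_0_conv
        less_imp_le mod_less_divisor mod_self not_numeral_le_zero replicate_empty rotate_conv_mod
        rotate_id rotate_rotate)
  then obtain w' where w': "length w' = length w" "XY_word p = concat (replicate p w')"
    using eq rotate_concat_replicate by metis
  have "length (XY_word p) = p * length w'"
    unfolding w'(2) by (simp add: length_concat sum_list_replicate)
  then have "p * 2 = p * length w'" by (simp add: XY_word_def flip: mult_2_right)
  then have "length w' = 2" using assms by simp
  moreover have "w' = take (length w') (XY_word p)"
    unfolding w'(2) using assms by (cases p) simp_all
  ultimately have "w' = [GenX, GenX]"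
    using assms by (simp add: XY_word_def min_absorb2 numeral_2_eq_2)
  then have "GenY \<notin> set (XY_word p)" unfolding w'(2) by simp
  then show False using assms by (simp add: XY_word_def)
qed

lemma letters_single_power:
  "Poly_Mapping.single (Word w) (n::int) ^ k
    = Poly_Mapping.single (Word (concat (replicate k w))) (n ^ k)"
proof (induction k)
  case 0
  show ?case by (simp flip: single_one add: zero_free_mon_def)
qed (simp add: mult_single plus_free_mon_def)

text \<open>Expand \<open>a\<close> into monomials. Modulo \<open>p\<close> the trace sees only
  their \<open>p\<close>-th powers, each a multiple of the \<open>p\<close>-th power of a word, on
  which it vanishes.\<close>

lemma cyc_coeff_power:
  assumes "prime p"
  shows "int p dvd cyc_coeff p (a ^ p)"
proof -
  have p2: "p \<ge> 2" using assms by (rule prime_ge_2_nat)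
  let ?c = "\<lambda>r. Poly_Mapping.single r (Poly_Mapping.lookup a r)"
  have "cyc_coeff p (?c r ^ p) = 0" for r
    using XY_word_not_power[OF p2] by (cases r) (simp add: letters_single_power cyc_coeff_def)
  moreover have "int p dvd cyc_coeff p ((\<Sum>r\<in>Poly_Mapping.keys a. ?c r) ^ p)
      - (\<Sum>r\<in>Poly_Mapping.keys a. cyc_coeff p (?c r ^ p))"
    by (rule trace_power_sum[OF assms]) (simp_all add: cyc_coeff_add cyc_coeff_comm)
  ultimately show ?thesis by (simp add: single_sum_eq)
qed

lemma cyc_coeff_XY:
  "cyc_coeff p (Poly_Mapping.single (Word [GenX]) 1 ^ p * Poly_Mapping.single (Word [GenY]) 1 ^ p) = 1"
proof -
  have "concat (replicate p [z]) = replicate p z" for z :: gen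
    by (induction p) simp_all
  moreover have "\<exists>n. XY_word p = rotate n (XY_word p)"
    by (rule exI[of _ 0]) simp
  ultimately show ?thesis
    by (simp add: letters_single_power mult_single plus_free_mon_def cyc_coeff_def flip: XY_word_def)
qed


section \<open>The closed subgroups \<open>X(S)\<close>\<close>

text \<open>Coordinates take values in a discrete space, so a condition on one coordinate defines a
  clopen set.\<close>

lemma seq_topology_coordinate:
  "openin seq_topology {x. x n \<in> T}" "closedin seq_topology {x. x n \<in> T}"
proof -
  have proj: "continuous_map seq_topology (discrete_topology UNIV) (\<lambda>x. x n)"
    unfolding seq_topology_def by (rule continuous_map_product_projection) simp
  show "openin seq_topology {x. x n \<in> T}"
    using openin_continuous_map_preimage[OF proj, of T] by (simp add: seq_topology_def)
  show "closedin seq_topology {x. x n \<in> T}"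
    using closedin_continuous_map_preimage[OF proj, of T] by (simp add: seq_topology_def)
qed

lemma inv_type_ring: "inv\<^bsub>add_monoid type_ring\<^esub> x = - (x :: 'a::ring_1)"
proof -
  interpret ring "type_ring :: 'a ring" by (rule ring_type_ring)
  show ?thesis
    by (rule group.inv_equality[OF add.group_axioms]) (simp_all add: type_ring_def)
qed

lemma subgroup_type_ringI:
  fixes H :: "'a::ring_1 set"
  assumes "0 \<in> H" "\<And>x y. x \<in> H \<Longrightarrow> y \<in> H \<Longrightarrow> x - y \<in> H"
  shows "subgroup H (add_monoid type_ring)"
proof -
  interpret ring "type_ring :: 'a ring" by (rule ring_type_ring)
  have neg: "- x \<in> H" if "x \<in> H" for x
    using assms(2)[OF assms(1) that] by simp
  show ?thesis
  proof (rule group.subgroupI[OF add.group_axioms])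
    show "H \<subseteq> carrier (add_monoid type_ring)" by (simp add: type_ring_def)
    show "H \<noteq> {}" using assms(1) by blast
    show "inv\<^bsub>add_monoid type_ring\<^esub> x \<in> H" if "x \<in> H" for x
      using neg[OF that] by (simp only: inv_type_ring)
    show "x \<otimes>\<^bsub>add_monoid type_ring\<^esub> y \<in> H" if "x \<in> H" "y \<in> H" for x y
      using assms(2)[OF that(1) neg[OF that(2)]] by (simp add: type_ring_def)
  qed
qed

text \<open>Minimality of the hull as an induction principle: a closed additive condition has to be
  checked on generators only.\<close>

lemma CD_X_subset:
  assumes "0 \<in> H" "\<And>x y. x \<in> H \<Longrightarrow> y \<in> H \<Longrightarrow> x - y \<in> H" "closedin seq_topology H"
    and "\<And>m bs. bs \<noteq> [] \<Longrightarrow> set bs \<subseteq> S \<Longrightarrow> (seq_V p ^^ m) (prod_list (map (seq_teich p) bs)) \<in> H"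
  shows "CD_X p S \<subseteq> H"
  unfolding CD_X_def using assms subgroup_type_ringI[of H]
  by (intro hull_minimal) auto

lemma CD_X_generator:
  assumes "bs \<noteq> []" "set bs \<subseteq> S"
  shows "(seq_V p ^^ m) (prod_list (map (seq_teich p) bs)) \<in> CD_X p S"
  unfolding CD_X_def using assms by (intro hull_inc) blast

lemma CD_X_zero: "0 \<in> CD_X p (S :: 'b::ring_1 set)"
  using subgroup.one_closed[OF subgroup_CD_X[of p S]] by (simp add: type_ring_def)

lemma CD_X_add: "x \<in> CD_X p S \<Longrightarrow> y \<in> CD_X p S \<Longrightarrow> x + y \<in> CD_X p (S :: 'b::ring_1 set)"
  using subgroup.m_closed[OF subgroup_CD_X[of p S]] by (simp add: type_ring_def)

lemma CD_X_uminus: "x \<in> CD_X p S \<Longrightarrow> - x \<in> CD_X p (S :: 'b::ring_1 set)"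
  using subgroup.m_inv_closed[OF subgroup_CD_X[of p S]] by (simp only: inv_type_ring)

lemma CD_X_diff: "x \<in> CD_X p S \<Longrightarrow> y \<in> CD_X p S \<Longrightarrow> x - y \<in> CD_X p (S :: 'b::ring_1 set)"
  using CD_X_add[OF _ CD_X_uminus, of x p S y] by simp

lemma CD_X_of_nat_mult: "x \<in> CD_X p S \<Longrightarrow> of_nat k * x \<in> CD_X p (S :: 'b::ring_1 set)"
  by (induction k) (simp_all add: CD_X_zero CD_X_add distrib_right)

lemma CD_X_mono: "S \<subseteq> T \<Longrightarrow> CD_X p S \<subseteq> CD_X p (T :: 'b::ring_1 set)"
  unfolding CD_X_def by (rule hull_mono) blast

section \<open>Closure of X(B) under multiplication\<close>

lemma seq_V_mult_seq_V: "seq_V p x * seq_V p y = of_nat p * seq_V p (x * y)"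
proof
  fix n
  show "(seq_V p x * seq_V p y) n = (of_nat p * seq_V p (x * y)) n"
    by (cases n) (simp_all add: seq_V_def of_nat_fun mult.assoc, metis mult.assoc mult_of_nat_commute)
qed

text \<open>The projection formula x V(y) = V(F(x) y), with the shift \<open>x \<circ> Suc\<close>
  in the role of the Frobenius F.\<close>

lemma mult_seq_V: "x * seq_V p y = seq_V p ((x \<circ> Suc) * y)"
proof
  fix n
  show "(x * seq_V p y) n = seq_V p ((x \<circ> Suc) * y) n"
    by (cases n) (simp_all add: seq_V_def, metis mult.assoc mult_of_nat_commute)
qed

lemma seq_V_mult: "seq_V p x * y = seq_V p (x * (y \<circ> Suc))"
proof
  fix n
  show "(seq_V p x * y) n = seq_V p (x * (y \<circ> Suc)) n"
    by (cases n) (simp_all add: seq_V_def mult.assoc)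
qed

text \<open>The shift sends the Teichmueller sequence of \<open>b\<close> to that of
  \<open>b ^ p\<close>, so it preserves products of such sequences.\<close>

lemma prod_seq_teich_Suc:
  "prod_list (map (seq_teich p) bs) \<circ> Suc = prod_list (map (seq_teich p) (map (\<lambda>b. b ^ p) bs))"
  by (induction bs) (auto simp: fun_eq_iff seq_teich_def power_mult)

text \<open>Induction on both exponents: a single outer V is pulled out by a projection formula, a
  pair of them by V(x)V(y) = pV(xy).\<close>

lemma CD_X_generator_mult:
  fixes bs cs :: "'b::ring_1 list"
  assumes "bs \<noteq> []" "cs \<noteq> []"
  shows "(seq_V p ^^ m) (prod_list (map (seq_teich p) bs)) *
    (seq_V p ^^ n) (prod_list (map (seq_teich p) cs)) \<in> CD_X p UNIV"
  using assms
proof (induction m arbitrary: n bs cs)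
  case 0
  then show ?case
  proof (induction n arbitrary: bs)
    case 0
    then show ?case
      using CD_X_generator[of "bs @ cs" UNIV 0 p] by (simp del: times_fun_apply)
  next
    case (Suc n)
    have "prod_list (map (seq_teich p) (map (\<lambda>b. b ^ p) bs))
        * (seq_V p ^^ n) (prod_list (map (seq_teich p) cs)) \<in> CD_X p UNIV"
      using Suc.IH[of "map (\<lambda>b. b ^ p) bs"] Suc.prems
      by (simp only: funpow_0 map_is_Nil_conv simp_thms)
    from seq_V_CD_X[OF this] show ?case
      unfolding prod_seq_teich_Suc[symmetric] mult_seq_V[symmetric]
      by (simp only: funpow.simps comp_apply id_apply)
  qed
next
  case (Suc m)
  show ?case
  proof (cases n)
    case 0
    have "(seq_V p ^^ m) (prod_list (map (seq_teich p) bs))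
        * prod_list (map (seq_teich p) (map (\<lambda>b. b ^ p) cs)) \<in> CD_X p UNIV"
      using Suc.IH[of bs "map (\<lambda>b. b ^ p) cs" 0] Suc.prems
      by (simp only: funpow_0 map_is_Nil_conv simp_thms)
    from seq_V_CD_X[OF this] show ?thesis
      unfolding prod_seq_teich_Suc[symmetric] seq_V_mult[symmetric] 0
      by (simp only: funpow.simps comp_apply id_apply)
  next
    case (Suc k)
    from CD_X_of_nat_mult[OF seq_V_CD_X[OF Suc.IH[OF Suc.prems, of k]], of p] show ?thesis
      unfolding seq_V_mult_seq_V[symmetric] Suc
      by (simp only: funpow.simps comp_apply)
  qed
qed

lemma continuous_map_seq_componentwise:
  "continuous_map seq_topology seq_topology (\<lambda>x n. f n (x n))"
  unfolding seq_topology_def continuous_map_componentwise_UNIV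
proof
  fix k
  have "continuous_map (product_topology (\<lambda>_. discrete_topology UNIV) UNIV)
      (discrete_topology UNIV) (f k \<circ> (\<lambda>x. x k))"
    by (rule continuous_map_compose[OF continuous_map_product_projection]) auto
  then show "continuous_map (product_topology (\<lambda>_. discrete_topology UNIV) UNIV)
      (discrete_topology UNIV) (\<lambda>x. f k (x k))"
    by (simp add: o_def)
qed

text \<open>Ensures that commutators of elements of X(B) stay in X(B). For one fixed factor the
  admissible other factors form a closed subgroup, so the check reduces to generators, one factor at
  a time.\<close>

lemma CD_X_mult:
  fixes x y :: "nat \<Rightarrow> 'b::ring_1"
  assumes "x \<in> CD_X p UNIV" "y \<in> CD_X p UNIV"
  shows "x * y \<in> CD_X p UNIV"
proof -
  let ?X = "CD_X p (UNIV :: 'b set)"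
  have closed: "closedin seq_topology {z. (\<lambda>n. f n (z n)) \<in> ?X}" for f
    using closedin_continuous_map_preimage[OF continuous_map_seq_componentwise closedin_CD_X]
    by (simp add: seq_topology_def)
  have right: "?X \<subseteq> {y. x * y \<in> ?X}"
    if x: "x = (seq_V p ^^ m) (prod_list (map (seq_teich p) bs))" "bs \<noteq> []" for x m bs
  proof (rule CD_X_subset)
    show "closedin seq_topology {y. x * y \<in> ?X}"
      using closed[of "\<lambda>n. (*) (x n)"] by (simp add: times_fun_def)
  qed (auto simp: CD_X_zero CD_X_diff right_diff_distrib x CD_X_generator_mult)
  have "?X \<subseteq> {x. x * y \<in> ?X}"
  proof (rule CD_X_subset)
    show "closedin seq_topology {x. x * y \<in> ?X}"
      using closed[of "\<lambda>n z. z * y n"] by (simp add: times_fun_def)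
    show "(seq_V p ^^ m) (prod_list (map (seq_teich p) bs)) \<in> {x. x * y \<in> ?X}"
      if "bs \<noteq> []" for m bs
      using right[OF refl that] assms(2) by blast
  qed (simp_all add: CD_X_zero CD_X_diff left_diff_distrib)
  then show ?thesis using assms(1) by blast
qed


section \<open>An invariant modulo \<open>p\<close> on \<open>HH\<^sub>0(E(\<int>{X,Y}))\<close>\<close>

text \<open>Its residue modulo \<open>p\<close> is the invariant; index 1 is where a Teichmueller
  element first shows a \<open>p\<close>-th power.\<close>

definition ghost_coeff :: "nat \<Rightarrow> (nat \<Rightarrow> ZXY mon_alg) \<Rightarrow> int"
  where "ghost_coeff p x = cyc_coeff p (mon_alg_eval (x 1))"

text \<open>Elements of E(A) are cosets, so nonvanishing of the invariant is stated through some
  representative; by \<open>nonzero_E_class\<close> the choice is immaterial.\<close>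

definition nonzero_E :: "nat \<Rightarrow> (nat \<Rightarrow> ZXY mon_alg) set \<Rightarrow> bool"
  where "nonzero_E p c \<longleftrightarrow> (\<exists>x\<in>c. \<not> int p dvd ghost_coeff p x)"

definition nonzero_HH0 :: "nat \<Rightarrow> (nat \<Rightarrow> ZXY mon_alg) set set \<Rightarrow> bool"
  where "nonzero_HH0 p C \<longleftrightarrow> (\<exists>c\<in>C. nonzero_E p c)"

lemma mon_alg_eval_add: "mon_alg_eval (x + y) = mon_alg_eval x + mon_alg_eval y"
  and mon_alg_eval_diff: "mon_alg_eval (x - y) = mon_alg_eval x - mon_alg_eval y"
  and mon_alg_eval_zero: "mon_alg_eval 0 = 0"
  by (simp_all add: mon_alg_eval_lin_ext lin_ext_add lin_ext_diff)

lemma mon_alg_eval_of_nat: "mon_alg_eval (of_nat n) = of_nat n"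
  by (induction n) (simp_all add: mon_alg_eval_add mon_alg_eval_zero)

lemma ghost_coeff_add: "ghost_coeff p (x + y) = ghost_coeff p x + ghost_coeff p y"
  and ghost_coeff_diff: "ghost_coeff p (x - y) = ghost_coeff p x - ghost_coeff p y"
  and ghost_coeff_zero: "ghost_coeff p 0 = 0"
  by (simp_all add: ghost_coeff_def mon_alg_eval_add mon_alg_eval_diff mon_alg_eval_zero
      cyc_coeff_add cyc_coeff_diff)

lemma ghost_coeff_commutator: "ghost_coeff p (x * y - y * x) = 0"
  by (simp add: ghost_coeff_def mon_alg_eval_diff mon_alg_eval_mult cyc_coeff_diff
      cyc_coeff_comm[of p "mon_alg_eval (x (Suc 0))"])

lemma ghost_coeff_seq_V: "int p dvd ghost_coeff p (seq_V p x)"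
  by (simp add: ghost_coeff_def seq_V_def mon_alg_eval_mult mon_alg_eval_of_nat cyc_coeff_of_nat_mult)

text \<open>For \<open>m = 0\<close> a factor of the generator evaluates to 0 in A; for larger
  \<open>m\<close> the outer V supplies a factor \<open>p\<close>.\<close>

lemma ghost_coeff_kernel:
  assumes "p > 0" "x \<in> CD_X p mon_alg_kernel"
  shows "int p dvd ghost_coeff p x"
proof -
  have "CD_X p mon_alg_kernel \<subseteq> {x. int p dvd ghost_coeff p x}"
  proof (rule CD_X_subset)
    show "closedin seq_topology {x. int p dvd ghost_coeff p x}"
      using seq_topology_coordinate(2)[of 1 "{z. int p dvd cyc_coeff p (mon_alg_eval z)}"]
      by (simp add: ghost_coeff_def)
    fix m and bs :: "ZXY mon_alg list"
    assume bs: "bs \<noteq> []" "set bs \<subseteq> mon_alg_kernel"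
    show "(seq_V p ^^ m) (prod_list (map (seq_teich p) bs)) \<in> {x. int p dvd ghost_coeff p x}"
    proof (cases m)
      case 0
      obtain b bs' where "bs = b # bs'" "mon_alg_eval b = 0"
        using bs by (cases bs) (auto simp: mon_alg_kernel_def)
      then show ?thesis
        using 0 assms(1)
        by (simp add: ghost_coeff_def seq_teich_def mon_alg_eval_mult mon_alg_eval_power zero_power)
    next
      case (Suc k)
      then show ?thesis by (simp add: ghost_coeff_seq_V)
    qed
  qed (auto simp: ghost_coeff_zero ghost_coeff_diff)
  with assms(2) show ?thesis by blast
qed

section \<open>The invariant on E(A) and on the closure of its commutators\<close>

lemma CD_E_class_eq: "CD_E_class p x = (\<lambda>y. y + x) ` CD_X p mon_alg_kernel"
  by (auto simp: CD_E_class_def r_coset_def CD_X_group_def type_ring_def)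

lemma nonzero_E_class:
  assumes "p > 0"
  shows "nonzero_E p (CD_E_class p x) \<longleftrightarrow> \<not> int p dvd ghost_coeff p x"
  using ghost_coeff_kernel[OF assms] CD_X_zero[of p mon_alg_kernel]
  by (auto simp: nonzero_E_def CD_E_class_eq ghost_coeff_add dvd_add_right_iff)

text \<open>The group operation is the sum of sets, so a representative of the product is a sum of
  representatives, and the coefficient is additive.\<close>

lemma nonzero_E_mult:
  assumes "nonzero_E p (c \<otimes>\<^bsub>CD_E p\<^esub> d)"
  shows "nonzero_E p c \<or> nonzero_E p d"
  using assms
  by (auto simp: nonzero_E_def CD_E_def FactGroup_def set_mult_def CD_X_group_def type_ring_def
      ghost_coeff_add intro: dvd_add)

lemma nonzero_HH0_mult:
  assumes "nonzero_HH0 p (C \<otimes>\<^bsub>HH0_E p\<^esub> D)"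
  shows "nonzero_HH0 p C \<or> nonzero_HH0 p D"
  using assms nonzero_E_mult
  by (fastforce simp: nonzero_HH0_def HH0_E_def FactGroup_def set_mult_def)

lemma normal_CD_X_kernel:
  "normal (CD_X p mon_alg_kernel) (CD_X_group p :: (nat \<Rightarrow> 'a::ring_1 mon_alg) monoid)"
proof -
  interpret ring "type_ring :: (nat \<Rightarrow> 'a mon_alg) ring" by (rule ring_type_ring)
  have "comm_group (CD_X_group p :: (nat \<Rightarrow> 'a mon_alg) monoid)"
    unfolding CD_X_group_def
    by (rule group.group_comm_groupI[OF add.subgroup_imp_group[OF subgroup_CD_X]])
      (simp add: type_ring_def add.commute)
  moreover have "subgroup (CD_X p mon_alg_kernel) (CD_X_group p :: (nat \<Rightarrow> 'a mon_alg) monoid)"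
    unfolding CD_X_group_def
    by (rule add.subgroup_incl[OF subgroup_CD_X subgroup_CD_X CD_X_mono]) simp
  ultimately show ?thesis by (rule comm_group.subgroup_imp_normal)
qed

lemma carrier_CD_E: "carrier (CD_E p) = CD_E_class p ` CD_X p UNIV"
  by (auto simp: CD_E_def FactGroup_def RCOSETS_def CD_E_class_def CD_X_group_def)

lemma CD_E_class_add:
  assumes "x \<in> CD_X p UNIV" "y \<in> CD_X p UNIV"
  shows "CD_E_class p x \<otimes>\<^bsub>CD_E p\<^esub> CD_E_class p y = CD_E_class p (x + y)"
  using normal.rcos_sum[OF normal_CD_X_kernel, of x p y] assms
  by (simp add: CD_E_def FactGroup_def CD_E_class_def CD_X_group_def type_ring_def)

lemma CD_E_class_zero: "CD_E_class p 0 = \<one>\<^bsub>CD_E p\<^esub>"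
  by (simp add: CD_E_class_eq CD_E_def FactGroup_def)

lemma CD_E_class_uminus:
  assumes "x \<in> CD_X p UNIV"
  shows "inv\<^bsub>CD_E p\<^esub> CD_E_class p x = CD_E_class p (- x)"
proof (rule group.inv_equality)
  show "Group.group (CD_E p)"
    unfolding CD_E_def by (rule normal.factorgroup_is_group[OF normal_CD_X_kernel])
qed (use assms in \<open>simp_all add: CD_E_class_add CD_X_uminus CD_E_class_zero carrier_CD_E\<close>)

lemma CD_E_commutators_vanish:
  assumes "p > 0" "c \<in> CD_E_commutators p"
  shows "c \<in> carrier (CD_E p) \<and> \<not> nonzero_E p c"
proof -
  \<comment> \<open>The induction keeps a representative with coefficient exactly 0, which yields
    both membership in the carrier and vanishing.\<close>
  have "\<exists>z\<in>CD_X p UNIV. c = CD_E_class p z \<and> ghost_coeff p z = 0"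
    using assms(2) unfolding CD_E_commutators_def
  proof (induction rule: generate.induct)
    case one
    show ?case
      using CD_X_zero CD_E_class_zero ghost_coeff_zero by metis
  next
    case (incl h)
    then show ?case
      using ghost_coeff_commutator by (auto intro!: bexI CD_X_diff CD_X_mult)
  next
    case (inv h)
    then obtain x y where xy: "h = CD_E_class p (x * y - y * x)" "x \<in> CD_X p UNIV" "y \<in> CD_X p UNIV"
      by blast
    \<comment> \<open>The inverse of a commutator is the commutator of the swapped pair.\<close>
    have "inv\<^bsub>CD_E p\<^esub> h = CD_E_class p (y * x - x * y)"
      using xy by (simp add: CD_E_class_uminus CD_X_diff CD_X_mult)
    then show ?case
      using xy ghost_coeff_commutator by (auto intro!: bexI CD_X_diff CD_X_mult)
  next
    case (eng h1 h2)
    then obtain z1 z2 where "z1 \<in> CD_X p UNIV" "z2 \<in> CD_X p UNIV" "h1 = CD_E_class p z1"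
      "h2 = CD_E_class p z2" "ghost_coeff p z1 = 0" "ghost_coeff p z2 = 0" by blast
    then show ?case
      by (intro bexI[of _ "z1 + z2"] conjI) (simp_all only: CD_E_class_add ghost_coeff_add CD_X_add add_0)
  qed
  then show ?thesis
    using nonzero_E_class[OF assms(1)] by (auto simp: carrier_CD_E)
qed

lemma topspace_quotient_topology: "topspace (quotient_topology T f) = f ` topspace T"
  using quotient_map_quotient_topology[of T f] by (simp add: quotient_map_def)

lemma topspace_CD_E: "topspace (CD_E_topology p) = carrier (CD_E p)"
  by (simp add: CD_E_topology_def topspace_quotient_topology carrier_CD_E seq_topology_def)

text \<open>Only the coordinate at index 1 enters, so the preimage in \<open>CD_X p UNIV\<close> is
  open, and the quotient topology transfers this.\<close>

lemma openin_nonzero_E: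
  assumes "p > 0"
  shows "openin (CD_E_topology p) {c \<in> carrier (CD_E p). nonzero_E p c}"
proof -
  have "{x \<in> CD_X p UNIV. nonzero_E p (CD_E_class p x)} =
      CD_X p UNIV \<inter> {x. x 1 \<in> {z. \<not> int p dvd cyc_coeff p (mon_alg_eval z)}}"
    by (auto simp: nonzero_E_class[OF assms] ghost_coeff_def)
  then have "openin (subtopology seq_topology (CD_X p UNIV))
      {x \<in> CD_X p UNIV. nonzero_E p (CD_E_class p x)}"
    using openin_subtopology_Int2[OF seq_topology_coordinate(1)] by (simp only:)
  moreover have "{x \<in> CD_X p UNIV. CD_E_class p x \<in> carrier (CD_E p) \<and> nonzero_E p (CD_E_class p x)}
      = {x \<in> CD_X p UNIV. nonzero_E p (CD_E_class p x)}"
    by (auto simp: carrier_CD_E)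
  ultimately show ?thesis
    by (auto simp: CD_E_topology_def openin_quotient_topology seq_topology_def carrier_CD_E)
qed

lemma closure_CD_E_commutators_vanish:
  assumes "p > 0" "c \<in> (CD_E_topology p) closure_of (CD_E_commutators p)"
  shows "\<not> nonzero_E p c"
proof -
  let ?Z = "carrier (CD_E p) - {c \<in> carrier (CD_E p). nonzero_E p c}"
  have "(CD_E_topology p) closure_of (CD_E_commutators p) \<subseteq> ?Z"
  proof (rule closure_of_minimal)
    show "CD_E_commutators p \<subseteq> ?Z" using CD_E_commutators_vanish[OF assms(1)] by blast
    show "closedin (CD_E_topology p) ?Z"
      using closedin_diff[OF closedin_topspace openin_nonzero_E[OF assms(1)]]
      by (simp only: topspace_CD_E)
  qed
  with assms(2) show ?thesis by blast
qed

section \<open>The invariant on HH_0(E(A))\<close>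

lemma nonzero_HH0_class:
  assumes "p > 0" "c \<in> carrier (CD_E p)"
  shows "nonzero_HH0 p (HH0_E_class p c) \<longleftrightarrow> nonzero_E p c"
proof
  assume "nonzero_HH0 p (HH0_E_class p c)"
  then obtain n where "n \<in> (CD_E_topology p) closure_of (CD_E_commutators p)"
    "nonzero_E p (n \<otimes>\<^bsub>CD_E p\<^esub> c)"
    by (auto simp: nonzero_HH0_def HH0_E_class_def r_coset_def)
  then show "nonzero_E p c"
    using nonzero_E_mult closure_CD_E_commutators_vanish[OF assms(1)] by blast
next
  assume c: "nonzero_E p c"
  let ?C = "CD_E_commutators p :: (nat \<Rightarrow> ZXY mon_alg) set set"
  \<comment> \<open>The unit lies in the closure, which puts \<open>c\<close> into its own
    class.\<close>
  have "\<one>\<^bsub>CD_E p\<^esub> \<in> ?C"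
    unfolding CD_E_commutators_def by (rule generate.one)
  moreover have "?C \<subseteq> (CD_E_topology p) closure_of ?C"
    using CD_E_commutators_vanish[OF assms(1)] by (intro closure_of_subset) (auto simp: topspace_CD_E)
  ultimately have "\<one>\<^bsub>CD_E p\<^esub> \<in> (CD_E_topology p) closure_of ?C"
    by blast
  moreover have "\<one>\<^bsub>CD_E p\<^esub> \<otimes>\<^bsub>CD_E p\<^esub> c = c"
    using assms(2) CD_E_class_add[OF CD_X_zero, of _ p]
    by (auto simp: carrier_CD_E simp flip: CD_E_class_zero)
  ultimately have "c \<in> HH0_E_class p c"
    by (force simp: HH0_E_class_def r_coset_def)
  with c show "nonzero_HH0 p (HH0_E_class p c)" by (auto simp: nonzero_HH0_def)
qed

lemma carrier_HH0_E: "carrier (HH0_E p) = HH0_E_class p ` carrier (CD_E p)"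
  by (auto simp: HH0_E_def FactGroup_def RCOSETS_def HH0_E_class_def)

lemma openin_nonzero_HH0:
  assumes "p > 0"
  shows "openin (HH0_E_topology p) {C \<in> carrier (HH0_E p). nonzero_HH0 p C}"
proof -
  have "{c \<in> carrier (CD_E p). HH0_E_class p c \<in> carrier (HH0_E p) \<and> nonzero_HH0 p (HH0_E_class p c)}
      = {c \<in> carrier (CD_E p). nonzero_E p c}"
    by (auto simp: carrier_HH0_E nonzero_HH0_class[OF assms])
  then show ?thesis
    using openin_nonzero_E[OF assms]
    by (auto simp: HH0_E_topology_def openin_quotient_topology topspace_CD_E carrier_HH0_E)
qed


section \<open>Decomposition and density in the Witt vectors\<close>

lemma omega_teich:
  assumes "p > 0"
  shows "omega p i (case_nat b (\<lambda>_. 0)) = b ^ (p ^ i)"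
proof -
  have "omega p i (case_nat b (\<lambda>_. 0)) = (\<Sum>j\<le>i. if j = 0 then b ^ (p ^ i) else 0)"
    unfolding omega_def using assms by (intro sum.cong) (auto simp: zero_power split: nat.split)
  then show ?thesis by simp
qed

text \<open>For i > 0 this is omega_i(a_0, a_1, ...) = a_0^(p^i) + p omega_(i-1)(a_1, a_2, ...); for
  i = 0 the second summand is 0.\<close>

lemma omega_teich_add_shift:
  assumes "p > 0"
  shows "omega p i a = omega p i (case_nat (a 0) (\<lambda>_. 0)) + omega p i (case_nat 0 (a \<circ> Suc))"
proof (cases i)
  case 0
  then show ?thesis using assms by (simp add: omega_def)
next
  case (Suc k)
  then show ?thesis
    using assms
    by (simp add: omega_teich omega_shift)
      (simp add: omega_def sum.atMost_Suc_shift sum_distrib_left mult.assoc del: sum.atMost_Suc)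
qed

lemma ab_class_add:
  fixes x y :: "'a::ring_1"
  shows "ab_class x \<otimes>\<^bsub>A_ab\<^esub> ab_class y = ab_class (x + y)"
proof -
  interpret abelian_group "type_ring :: 'a ring"
    using ring_type_ring by (rule ring.is_abelian_group)
  have "normal (commutator_subgroup type_ring) (add_monoid (type_ring :: 'a ring))"
    by (intro comm_group.subgroup_imp_normal a_comm_group subgroup_commutator_subgroup)
  from normal.rcos_sum[OF this, of x y] show ?thesis
    by (simp add: A_ab_def FactGroup_def ab_class_def a_r_coset_def type_ring_def)
qed

text \<open>Witt vectors are given by their ghost components, where this is the splitting of
  \<open>omega\<close> modulo commutators.\<close>

lemma Witt_q_decomposition:
  assumes "p > 0"
  shows "Witt_q p a = Witt_teich p (a 0) \<otimes>\<^bsub>Witt p\<^esub> Witt_V p (Witt_q p (a \<circ> Suc))"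
  unfolding Witt_V_q[OF assms] Witt_teich_def
  by (auto simp: Witt_q_def Witt_def Witt_trunc_def product_group_def omega_trunc_def fun_eq_iff
      ab_class_add simp flip: omega_teich_add_shift[OF assms, of _ a])

lemma topspace_Witt: "topspace (Witt_topology p) = carrier (Witt p)"
  by (auto simp: Witt_topology_def Witt_def)

text \<open>A basic open set constrains only finitely many truncation levels, and an
  \<open>a\<close> representing \<open>w\<close> at a level above them all represents it at every
  lower one.\<close>

lemma Witt_q_dense:
  assumes "openin (Witt_topology p) U" "w \<in> U"
  obtains a where "Witt_q p a \<in> U"
proof -
  obtain V where V: "U = V \<inter> carrier (Witt p)"
    "openin (product_topology (\<lambda>n. discrete_topology (carrier (Witt_trunc p n))) {1..}) V"
    using assms(1) by (auto simp: Witt_topology_def openin_subtopology)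
  obtain F where F: "finite {i \<in> {1..}. F i \<noteq> carrier (Witt_trunc p i)}"
    "w \<in> Pi\<^sub>E {1..} F" "Pi\<^sub>E {1..} F \<subseteq> V"
    using V assms(2) by (force simp: openin_product_topology_alt)
  have w: "w n \<in> range (omega_trunc p n)" "restrict (w (Suc n)) {..<n} = w n" if "n \<ge> 1" for n
    using V(1) assms(2) that by (auto simp: Witt_def Witt_trunc_def PiE_iff)
  obtain N where N: "N \<ge> 1" "\<And>i. i \<ge> 1 \<Longrightarrow> F i \<noteq> carrier (Witt_trunc p i) \<Longrightarrow> i \<le> N"
    using F(1) finite_nat_set_iff_bounded_le[of "{i \<in> {1..}. F i \<noteq> carrier (Witt_trunc p i)}"]
    by (metis (mono_tags, lifting) atLeast_iff le_SucI le_add1 mem_Collect_eq plus_1_eq_Suc)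
  obtain a where a: "w N = omega_trunc p N a" using w(1)[OF N(1)] by blast
  \<comment> \<open>Compatibility with truncation is used downwards from \<open>N\<close>.\<close>
  have "w i = omega_trunc p i a" if "i \<le> N" "i \<ge> 1" for i
    using that
  proof (induction i rule: inc_induct)
    case base
    then show ?case using a by simp
  next
    case (step k)
    then have "w k = restrict (omega_trunc p (Suc k) a) {..<k}" using w(2)[of k] by simp
    then show ?case by (auto simp: omega_trunc_def fun_eq_iff)
  qed
  then have eq: "Witt_q p a i = w i" if "i \<le> N" "i \<ge> 1" for i
    using that by (simp add: Witt_q_def)
  have "Witt_q p a i \<in> F i" if "i \<ge> 1" for i
  proof (cases "F i = carrier (Witt_trunc p i)")
    case True
    then show ?thesis using that by (simp add: Witt_q_def Witt_trunc_def)
  next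
    case False
    then show ?thesis using eq[OF N(2)] F(2) that by (auto simp: PiE_iff)
  qed
  then have "Witt_q p a \<in> Pi\<^sub>E {1..} F" by (auto simp: Witt_q_def)
  then have "Witt_q p a \<in> U" using F(3) V(1) Witt_q_in_carrier by blast
  then show ?thesis by (rule that)
qed

section \<open>The obstruction to surjectivity\<close>

theorem theorem1p1:
  fixes p :: nat
  assumes "prime p"
  shows "\<not> (\<exists>\<Psi> :: (nat \<Rightarrow> nat \<Rightarrow> ZXY set) \<Rightarrow> (nat \<Rightarrow> ZXY mon_alg) set set.
      \<Psi> \<in> hom (Witt p) (HH0_E p) \<and>
      continuous_map (Witt_topology p) (HH0_E_topology p) \<Psi> \<and>
      \<Psi> ` carrier (Witt p) = carrier (HH0_E p) \<and>
      (\<forall>w \<in> carrier (Witt p). HH0_E_V_graph p (\<Psi> w) (\<Psi> (Witt_V p w))) \<and>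
      (\<forall>a :: ZXY. \<Psi> (Witt_teich p a) = HH0_E_teich p a))"
proof
  assume "\<exists>\<Psi> :: (nat \<Rightarrow> nat \<Rightarrow> ZXY set) \<Rightarrow> (nat \<Rightarrow> ZXY mon_alg) set set.
      \<Psi> \<in> hom (Witt p) (HH0_E p) \<and>
      continuous_map (Witt_topology p) (HH0_E_topology p) \<Psi> \<and>
      \<Psi> ` carrier (Witt p) = carrier (HH0_E p) \<and>
      (\<forall>w \<in> carrier (Witt p). HH0_E_V_graph p (\<Psi> w) (\<Psi> (Witt_V p w))) \<and>
      (\<forall>a :: ZXY. \<Psi> (Witt_teich p a) = HH0_E_teich p a)"
  then obtain \<Psi> :: "(nat \<Rightarrow> nat \<Rightarrow> ZXY set) \<Rightarrow> (nat \<Rightarrow> ZXY mon_alg) set set"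
    where hom: "\<Psi> \<in> hom (Witt p) (HH0_E p)"
      and cont: "continuous_map (Witt_topology p) (HH0_E_topology p) \<Psi>"
      and surj: "\<Psi> ` carrier (Witt p) = carrier (HH0_E p)"
      and V: "\<And>w. w \<in> carrier (Witt p) \<Longrightarrow> HH0_E_V_graph p (\<Psi> w) (\<Psi> (Witt_V p w))"
      and teich: "\<And>a. \<Psi> (Witt_teich p a) = HH0_E_teich p a"
    by blast
  have p0: "p > 0" using assms prime_gt_0_nat by blast
  have vanish: "\<not> nonzero_HH0 p (\<Psi> (Witt_q p a))" for a
  proof -
    \<comment> \<open>At index 1 the Teichmueller element evaluates to \<open>a 0 ^ p\<close>, to
      which \<open>cyc_coeff_power\<close> applies.\<close>
    have "\<not> nonzero_HH0 p (HH0_E_teich p (a 0))"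
    proof -
      have "seq_teich p (mon_alg_basis (a 0)) \<in> CD_X p UNIV"
        using CD_X_generator[of "[mon_alg_basis (a 0)]" UNIV 0 p] by simp
      moreover have "int p dvd ghost_coeff p (seq_teich p (mon_alg_basis (a 0)))"
        using cyc_coeff_power[OF assms]
        by (simp add: ghost_coeff_def seq_teich_def mon_alg_eval_power)
      ultimately show ?thesis
        by (simp add: HH0_E_teich_def CD_E_teich_def nonzero_HH0_class nonzero_E_class p0 carrier_CD_E)
    qed
    \<comment> \<open>The relation for V presents this value as the class of some V x, whose
      coefficient is divisible by \<open>p\<close>.\<close>
    moreover have "\<not> nonzero_HH0 p (\<Psi> (Witt_V p (Witt_q p (a \<circ> Suc))))"
    proof -
      obtain x where "x \<in> CD_X p UNIV"
        "\<Psi> (Witt_V p (Witt_q p (a \<circ> Suc))) = HH0_E_class p (CD_E_V p (CD_E_class p x))"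
        using V[OF Witt_q_in_carrier[of p "a \<circ> Suc"]] by (auto simp: HH0_E_V_graph_def carrier_CD_E)
      then show ?thesis
        by (simp add: CD_E_V_class nonzero_HH0_class nonzero_E_class p0 carrier_CD_E seq_V_CD_X
            ghost_coeff_seq_V)
    qed
    moreover have "\<Psi> (Witt_q p a)
        = \<Psi> (Witt_teich p (a 0)) \<otimes>\<^bsub>HH0_E p\<^esub> \<Psi> (Witt_V p (Witt_q p (a \<circ> Suc)))"
      unfolding Witt_q_decomposition[OF p0, of a] using hom
      by (rule hom_mult) (simp_all add: Witt_teich_def Witt_V_q[OF p0] Witt_q_in_carrier)
    ultimately show ?thesis
      using nonzero_HH0_mult teich by metis
  qed
  \<comment> \<open>If this open set is nonempty, density puts some \<open>Witt_q p a\<close> into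
    it, contradicting \<open>vanish\<close>.\<close>
  let ?U = "{w \<in> topspace (Witt_topology p). \<Psi> w \<in> {C \<in> carrier (HH0_E p). nonzero_HH0 p C}}"
  have U: "openin (Witt_topology p) ?U"
    using openin_continuous_map_preimage[OF cont openin_nonzero_HH0[OF p0]] .
  let ?X = "Poly_Mapping.single (Word [GenX]) 1 :: ZXY"
  let ?Y = "Poly_Mapping.single (Word [GenY]) 1 :: ZXY"
  \<comment> \<open>The element <X><Y>: at index 1 it evaluates to X^p Y^p, whose cyclic coefficient
    is 1.\<close>
  let ?z = "seq_teich p (mon_alg_basis ?X) * seq_teich p (mon_alg_basis ?Y)"
  have z: "?z \<in> CD_X p UNIV"
    using CD_X_generator[of "[mon_alg_basis ?X, mon_alg_basis ?Y]" UNIV 0 p] by simp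
  have "ghost_coeff p ?z = 1"
    using cyc_coeff_XY[of p]
    by (simp add: ghost_coeff_def seq_teich_def mon_alg_eval_power mon_alg_eval_mult)
  then have "nonzero_HH0 p (HH0_E_class p (CD_E_class p ?z))"
    using z prime_gt_1_nat[OF assms]
    by (simp add: nonzero_HH0_class nonzero_E_class p0 carrier_CD_E)
  moreover have im: "HH0_E_class p (CD_E_class p ?z) \<in> \<Psi> ` carrier (Witt p)"
    using z by (simp add: surj carrier_HH0_E carrier_CD_E)
  then obtain w where "w \<in> carrier (Witt p)" "\<Psi> w = HH0_E_class p (CD_E_class p ?z)" by auto
  ultimately have "w \<in> ?U" using im surj by (simp add: topspace_Witt)
  with U obtain a where "Witt_q p a \<in> ?U" by (rule Witt_q_dense)
  with vanish show False by blast
qed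

end
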